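(* Let $s\in(0,1/2)$ and $\sigma=2s$. Fix a set $E_0\subseteq\mathbb R^n$ with locally finite $\sigma$-perimeter, and let $u_0:=\chi_{E_0}-\chi_{E_0^c}$. Let $(u,E)$ be a minimizing pair in $B_1$ with respect to the external datum $(u_0,E_0)$ outside $B_1$. Then it is not true that $u=\chi_E-\chi_{E^c}$ (a.e.), unless either $E=\mathbb R^n$ or $E=\varnothing$ (up to sets of measure zero).
   Context: $B_r=\{x\in\mathbb R^n:|x|<r\}$; $A^c=\mathbb R^n\setminus A$. For disjoint measurable $A,B\subseteq\mathbb R^n$ let $\mathcal L(A,B)=\iint_{A\times B}\frac{dx\,dy}{|x-y|^{n+\sigma}}$. For a bounded Lipschitz domain $\Omega\subset\mathbb R^n$ and measurable $E\subseteq\mathbb R^n$, $$\mathrm{Per}_\sigma(E,\Omega)=\mathcal L(E\cap\Omega,E^c\cap\Omega)+\mathcal L(E\cap\Omega,E^c\cap\Omega^c)+\mathcal L(E\cap\Omega^c,E^c\cap\Omega),$$ $$\mathcal F(u,E)=\iint_{\mathbb R^{2n}\setminus(\Omega^c)^2}\frac{|u(x)-u(y)|^2}{|x-y|^{n+2s}}\,dx\,dy+\mathrm{Per}_\sigma(E,\Omega).$$ Minimizing pair in $\Omega$ with respect to external datum $(\varphi,E_0)$, where $\varphi\in H^s_{\rm loc}(\mathbb R^n)$, $\varphi\ge0$ a.e. in $E_0$, $\varphi\le0$ a.e. in $E_0^c$: a pair $(v,F)$ is admissible if $v-\varphi\in H^s(\mathbb R^n)$, $v=\varphi$ a.e. in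 $\Omega^c$, $F\subseteq\mathbb R^n$ is measurable with $F\setminus\Omega=E_0\setminus\Omega$, and $v\ge0$ a.e. in $F\cap\Omega$, $v\le0$ a.e. in $F^c\cap\Omega$. The pair $(u,E)$ is minimizing if it is admissible and $\mathcal F(u,E)\le\mathcal F(v,F)$ for every admissible $(v,F)$. Here $\Omega=B_1$ and $\varphi=u_0$. *)

theory Defs
  imports "HOL-Analysis.Analysis"
begin

text \<open>
  All energies are \<^typ>\<open>ennreal\<close>-valued, so they may be infinite.  On the diagonal the kernels
  below take the value 0, since \<open>0 powr a = 0\<close> and division by zero gives zero; the diagonal has
  measure zero, so this convention does not affect the integrals.
\<close>

definition interaction :: "real \<Rightarrow> (real ^ 'n) set \<Rightarrow> (real ^ 'n) set \<Rightarrow> ennreal" where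
  "interaction \<sigma> A B =
     (\<integral>\<^sup>+p\<in>A \<times> B. ennreal (1 / norm (fst p - snd p) powr (real CARD('n) + \<sigma>))
        \<partial>(lebesgue \<Otimes>\<^sub>M lebesgue))"

definition frac_perimeter :: "real \<Rightarrow> (real ^ 'n) set \<Rightarrow> (real ^ 'n) set \<Rightarrow> ennreal" where
  "frac_perimeter \<sigma> E \<Omega> =
     interaction \<sigma> (E \<inter> \<Omega>) (- E \<inter> \<Omega>)
   + interaction \<sigma> (E \<inter> \<Omega>) (- E \<inter> - \<Omega>)
   + interaction \<sigma> (E \<inter> - \<Omega>) (- E \<inter> \<Omega>)"

text \<open>
  Testing on balls centred at the origin is enough, because
  \<^term>\<open>frac_perimeter \<sigma> E \<Omega>\<close> is monotone in \<open>\<Omega>\<close>.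
\<close>

definition locally_finite_perimeter :: "real \<Rightarrow> (real ^ 'n) set \<Rightarrow> bool" where
  "locally_finite_perimeter \<sigma> E \<longleftrightarrow> (\<forall>R>0. frac_perimeter \<sigma> E (ball 0 R) < \<infinity>)"

definition gagliardo_energy ::
    "real \<Rightarrow> ((real ^ 'n) \<times> (real ^ 'n)) set \<Rightarrow> (real ^ 'n \<Rightarrow> real) \<Rightarrow> ennreal" where
  "gagliardo_energy s Q u =
     (\<integral>\<^sup>+p\<in>Q. ennreal (\<bar>u (fst p) - u (snd p)\<bar>\<^sup>2 /
                      norm (fst p - snd p) powr (real CARD('n) + 2 * s))
        \<partial>(lebesgue \<Otimes>\<^sub>M lebesgue))"

definition frac_sobolev :: "real \<Rightarrow> (real ^ 'n) set \<Rightarrow> (real ^ 'n \<Rightarrow> real) set" where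
  "frac_sobolev s A =
     {u. u \<in> borel_measurable (lebesgue_on A) \<and>
         integrable (lebesgue_on A) (\<lambda>x. (u x)\<^sup>2) \<and>
         gagliardo_energy s (A \<times> A) u < \<infinity>}"

definition frac_sobolev_loc :: "real \<Rightarrow> (real ^ 'n \<Rightarrow> real) set" where
  "frac_sobolev_loc s = {u. \<forall>R>0. u \<in> frac_sobolev s (ball 0 R)}"

definition total_energy ::
    "real \<Rightarrow> real \<Rightarrow> (real ^ 'n) set \<Rightarrow> (real ^ 'n \<Rightarrow> real) \<Rightarrow> (real ^ 'n) set \<Rightarrow> ennreal" where
  "total_energy s \<sigma> \<Omega> u E =
     gagliardo_energy s (UNIV - (- \<Omega>) \<times> (- \<Omega>)) u + frac_perimeter \<sigma> E \<Omega>"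

definition external_datum :: "real \<Rightarrow> (real ^ 'n \<Rightarrow> real) \<Rightarrow> (real ^ 'n) set \<Rightarrow> bool" where
  "external_datum s \<phi> E\<^sub>0 \<longleftrightarrow>
     \<phi> \<in> frac_sobolev_loc s \<and>
     (AE x in lebesgue. x \<in> E\<^sub>0 \<longrightarrow> \<phi> x \<ge> 0) \<and>
     (AE x in lebesgue. x \<notin> E\<^sub>0 \<longrightarrow> \<phi> x \<le> 0)"

definition admissible_pair ::
    "real \<Rightarrow> (real ^ 'n) set \<Rightarrow> (real ^ 'n \<Rightarrow> real) \<Rightarrow> (real ^ 'n) set
      \<Rightarrow> (real ^ 'n \<Rightarrow> real) \<Rightarrow> (real ^ 'n) set \<Rightarrow> bool" where
  "admissible_pair s \<Omega> \<phi> E\<^sub>0 v F \<longleftrightarrow>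
     (\<lambda>x. v x - \<phi> x) \<in> frac_sobolev s UNIV \<and>
     (AE x in lebesgue. x \<notin> \<Omega> \<longrightarrow> v x = \<phi> x) \<and>
     F \<in> sets lebesgue \<and>
     F - \<Omega> = E\<^sub>0 - \<Omega> \<and>
     (AE x in lebesgue. x \<in> F \<inter> \<Omega> \<longrightarrow> v x \<ge> 0) \<and>
     (AE x in lebesgue. x \<in> - F \<inter> \<Omega> \<longrightarrow> v x \<le> 0)"

definition minimizing_pair ::
    "real \<Rightarrow> real \<Rightarrow> (real ^ 'n) set \<Rightarrow> (real ^ 'n \<Rightarrow> real) \<Rightarrow> (real ^ 'n) set
      \<Rightarrow> (real ^ 'n \<Rightarrow> real) \<Rightarrow> (real ^ 'n) set \<Rightarrow> bool" where
  "minimizing_pair s \<sigma> \<Omega> \<phi> E\<^sub>0 u E \<longleftrightarrow>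
     external_datum s \<phi> E\<^sub>0 \<and>
     admissible_pair s \<Omega> \<phi> E\<^sub>0 u E \<and>
     (\<forall>v F. admissible_pair s \<Omega> \<phi> E\<^sub>0 v F \<longrightarrow>
        total_energy s \<sigma> \<Omega> u E \<le> total_energy s \<sigma> \<Omega> v F)"

end

theory Submission
  imports Defs
begin

text \<open>
  Suppose \<open>u = \<chi>\<^sub>E - \<chi>\<^bsub>- E\<^esub>\<close>. The competitors \<open>u - t \<eta> u\<close>, with \<open>\<eta>(x) = max 0 (1 - |x|)\<close> and
  \<open>0 < t \<le> 1\<close>, keep the sign of \<open>u\<close>, hence are admissible together with the same set \<open>E\<close>. Damping
  lowers the Gagliardo energy to first order by \<open>4 t J\<close>, where \<open>J\<close> integrates
  \<open>(\<eta>(x) + \<eta>(y)) / |x - y|\<^bsup>n+2s\<^esup>\<close> over the pairs on opposite sides of \<open>E\<close>, and raises it only by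
  \<open>t\<^sup>2\<close> times the finite energy of \<open>\<eta> u\<close>. Minimality therefore forces \<open>J = 0\<close>, so that both
  \<open>(E \<inter> B\<^sub>1) \<times> (- E)\<close> and \<open>E \<times> (- E \<inter> B\<^sub>1)\<close> are null sets. If neither \<open>E\<close> nor \<open>- E\<close> were null, the
  whole ball \<open>B\<^sub>1\<close> would be. The energy of \<open>(u, E)\<close> is finite because \<open>(u\<^sub>0, E\<^sub>0)\<close> itself is a
  competitor, with energy 9 times the perimeter of \<open>E\<^sub>0\<close> in \<open>B\<^sub>1\<close>.
\<close>

section \<open>Products of Lebesgue measure and the Riesz kernel\<close>

lemma sigma_finite_lebesgue:
  "sigma_finite_measure (lebesgue :: ('a::euclidean_space) measure)"
proof -
  obtain A :: "'a set set" where "countable A" "A \<subseteq> sets lborel" "\<Union>A = space lborel"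
    "\<forall>a\<in>A. emeasure lborel a \<noteq> \<infinity>"
    using lborel.sigma_finite_countable by metis
  then show ?thesis
    by (intro sigma_finite_measure.intro exI[of _ A]) auto
qed

lemma pair_sigma_finite_lebesgue:
  "pair_sigma_finite (lebesgue :: 'a::euclidean_space measure) (lebesgue :: 'b::euclidean_space measure)"
  by (simp add: pair_sigma_finite_def sigma_finite_lebesgue)

text \<open>The same kernel serves the perimeter (\<open>r = \<sigma>\<close>) and the Gagliardo
  energy (\<open>r = 2 * s\<close>). Kept as a separate \<open>ennreal\<close> factor, it turns both
  into integrals of products with indicators.\<close>

definition riesz_kernel :: "real \<Rightarrow> (real ^ 'n) \<times> (real ^ 'n) \<Rightarrow> ennreal" where
  "riesz_kernel r p = ennreal (1 / norm (fst p - snd p) powr (real CARD('n) + r))"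

text \<open>The identity is measurable from \<open>lebesgue\<close> to \<open>borel\<close>, so both
  projections are Borel-valued maps, and Borel operations on them stay measurable on the
  product.\<close>

lemma borel_measurable_norm_diff_lebesgue_pair [measurable]:
  "(\<lambda>p. norm (fst p - snd p)) \<in>
     borel_measurable ((lebesgue :: 'a::euclidean_space measure) \<Otimes>\<^sub>M lebesgue)"
proof -
  have id: "(\<lambda>x. x) \<in> (lebesgue :: 'a measure) \<rightarrow>\<^sub>M borel"
    by (simp add: measurable_completion)
  note [measurable] = measurable_compose[OF measurable_fst id] measurable_compose[OF measurable_snd id]
  show ?thesis by measurable
qed

lemma borel_measurable_riesz_kernel [measurable]:
  "riesz_kernel r \<in> borel_measurable (lebesgue \<Otimes>\<^sub>M lebesgue)"
  unfolding riesz_kernel_def[abs_def] by measurable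

lemma interaction_eq:
  "interaction r A B =
    (\<integral>\<^sup>+p. riesz_kernel r p * indicator (A \<times> B) p \<partial>(lebesgue \<Otimes>\<^sub>M lebesgue))"
  by (simp add: interaction_def riesz_kernel_def)

lemma gagliardo_energy_eq:
  "gagliardo_energy s Q u =
    (\<integral>\<^sup>+p. ennreal ((u (fst p) - u (snd p))\<^sup>2) * riesz_kernel (2 * s) p * indicator Q p
       \<partial>(lebesgue \<Otimes>\<^sub>M lebesgue))"
  unfolding gagliardo_energy_def riesz_kernel_def
  by (simp add: ennreal_mult'[symmetric])

section \<open>The energy of a sign function as a perimeter\<close>

lemma interaction_commute:
  assumes [measurable]: "A \<in> sets lebesgue" "B \<in> sets lebesgue"
  shows "interaction r A B = interaction r B A"
proof -
  interpret pair_sigma_finite "lebesgue :: (real^'n) measure" "lebesgue :: (real^'n) measure"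
    by (rule pair_sigma_finite_lebesgue)
  let ?f = "\<lambda>p. riesz_kernel r p * indicator (A \<times> B) p"
  have "interaction r A B = (\<integral>\<^sup>+p. ?f p \<partial>distr (lebesgue \<Otimes>\<^sub>M lebesgue) (lebesgue \<Otimes>\<^sub>M lebesgue) (\<lambda>(x, y). (y, x)))"
    by (simp add: interaction_eq flip: distr_pair_swap)
  also have "\<dots> = (\<integral>\<^sup>+p. ?f (case p of (x, y) \<Rightarrow> (y, x)) \<partial>(lebesgue \<Otimes>\<^sub>M lebesgue))"
    by (rule nn_integral_distr) measurable
  also have "\<dots> = interaction r B A"
    unfolding interaction_eq
    by (intro nn_integral_cong)
       (auto simp: riesz_kernel_def norm_minus_commute indicator_def split: prod.splits)
  finally show ?thesis .
qed

text \<open>The squared difference is 4 on pairs on opposite sides of \<open>E\<close> and 0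
  elsewhere. Inside the domain of integration the opposite pairs split into six disjoint rectangles:
  the three of the perimeter and their mirror images, which contribute equally. This gives 4 * 2 =
  8.\<close>

lemma gagliardo_energy_sign_function:
  fixes E \<Omega> :: "(real ^ 'n) set"
  assumes [measurable]: "E \<in> sets lebesgue" "\<Omega> \<in> sets lebesgue"
  shows "gagliardo_energy s (UNIV - (- \<Omega>) \<times> (- \<Omega>)) (\<lambda>x. indicator E x - indicator (- E) x)
    = 8 * frac_perimeter (2 * s) E \<Omega>"
proof -
  let ?K = "riesz_kernel (2 * s) :: (real^'n) \<times> (real^'n) \<Rightarrow> ennreal"
  have [measurable]: "- E \<in> sets lebesgue" "- \<Omega> \<in> sets lebesgue"
    using assms by (auto simp: Compl_eq_Diff_UNIV)
  define I where "I A B p = ?K p * indicator (A \<times> B) p" for A B p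
  have [measurable]: "I A B \<in> borel_measurable (lebesgue \<Otimes>\<^sub>M lebesgue)"
    if [measurable]: "A \<in> sets lebesgue" "B \<in> sets lebesgue" for A B
    unfolding I_def[abs_def] by measurable
  have "gagliardo_energy s (UNIV - (- \<Omega>) \<times> (- \<Omega>)) (\<lambda>x. indicator E x - indicator (- E) x)
     = (\<integral>\<^sup>+p. 4 * (I (E \<inter> \<Omega>) (- E \<inter> \<Omega>) p + I (E \<inter> \<Omega>) (- E \<inter> - \<Omega>) p + I (E \<inter> - \<Omega>) (- E \<inter> \<Omega>) p
       + I (- E \<inter> \<Omega>) (E \<inter> \<Omega>) p + I (- E \<inter> - \<Omega>) (E \<inter> \<Omega>) p + I (- E \<inter> \<Omega>) (E \<inter> - \<Omega>) p) \<partial>(lebesgue \<Otimes>\<^sub>M lebesgue))"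
    unfolding gagliardo_energy_eq I_def
  proof (rule nn_integral_cong)
    fix p :: "(real^'n) \<times> (real^'n)"
    show "ennreal ((indicator E (fst p) - indicator (- E) (fst p) - (indicator E (snd p) - indicator (- E) (snd p)))\<^sup>2)
        * ?K p * indicator (UNIV - (- \<Omega>) \<times> (- \<Omega>)) p
      = 4 * (?K p * indicator ((E \<inter> \<Omega>) \<times> (- E \<inter> \<Omega>)) p + ?K p * indicator ((E \<inter> \<Omega>) \<times> (- E \<inter> - \<Omega>)) p
       + ?K p * indicator ((E \<inter> - \<Omega>) \<times> (- E \<inter> \<Omega>)) p + ?K p * indicator ((- E \<inter> \<Omega>) \<times> (E \<inter> \<Omega>)) p
       + ?K p * indicator ((- E \<inter> - \<Omega>) \<times> (E \<inter> \<Omega>)) p + ?K p * indicator ((- E \<inter> \<Omega>) \<times> (E \<inter> - \<Omega>)) p)"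
      by (cases p; cases "fst p \<in> E"; cases "snd p \<in> E"; cases "fst p \<in> \<Omega>"; cases "snd p \<in> \<Omega>") simp_all
  qed
  also have "\<dots> = 4 * (interaction (2 * s) (E \<inter> \<Omega>) (- E \<inter> \<Omega>) + interaction (2 * s) (E \<inter> \<Omega>) (- E \<inter> - \<Omega>)
      + interaction (2 * s) (E \<inter> - \<Omega>) (- E \<inter> \<Omega>)
      + interaction (2 * s) (- E \<inter> \<Omega>) (E \<inter> \<Omega>) + interaction (2 * s) (- E \<inter> - \<Omega>) (E \<inter> \<Omega>)
      + interaction (2 * s) (- E \<inter> \<Omega>) (E \<inter> - \<Omega>))"
    unfolding interaction_eq I_def[symmetric]
    by (simp add: nn_integral_add nn_integral_cmult)
  also have "\<dots> = 4 * (2 * frac_perimeter (2 * s) E \<Omega>)"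
  proof -
    have "interaction (2 * s) (- E \<inter> \<Omega>) (E \<inter> \<Omega>) = interaction (2 * s) (E \<inter> \<Omega>) (- E \<inter> \<Omega>)"
      "interaction (2 * s) (- E \<inter> - \<Omega>) (E \<inter> \<Omega>) = interaction (2 * s) (E \<inter> \<Omega>) (- E \<inter> - \<Omega>)"
      "interaction (2 * s) (- E \<inter> \<Omega>) (E \<inter> - \<Omega>) = interaction (2 * s) (E \<inter> - \<Omega>) (- E \<inter> \<Omega>)"
      by (intro interaction_commute; measurable)+
    then show ?thesis
      unfolding frac_perimeter_def by (simp only: mult_2 add.assoc)
  qed
  also have "\<dots> = 8 * frac_perimeter (2 * s) E \<Omega>"
    by (simp add: mult.assoc[symmetric])
  finally show ?thesis .
qed

section \<open>Sums, multiples and almost everywhere changes in the fractional Sobolev space\<close>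

lemma power2_add_le: "(a + b)\<^sup>2 \<le> 2 * a\<^sup>2 + 2 * b\<^sup>2" for a b :: real
  using sum_squares_ge_zero[of "a - b" 0] by (simp add: power2_eq_square algebra_simps)

text \<open>Only finiteness of the energy of a sum is wanted, so the crude factor 2 from squaring
  replaces the triangle inequality and avoids square roots.\<close>

lemma gagliardo_energy_add_le:
  fixes u v :: "real ^ 'n \<Rightarrow> real"
  assumes [measurable]: "u \<in> borel_measurable lebesgue" "v \<in> borel_measurable lebesgue"
  shows "gagliardo_energy s UNIV (\<lambda>x. u x + v x)
    \<le> 2 * gagliardo_energy s UNIV u + 2 * gagliardo_energy s UNIV v"
proof -
  have *: "ennreal ((u x + v x - (u y + v y))\<^sup>2) \<le> 2 * ennreal ((u x - u y)\<^sup>2) + 2 * ennreal ((v x - v y)\<^sup>2)" for x y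
  proof -
    have "(u x + v x - (u y + v y))\<^sup>2 \<le> 2 * (u x - u y)\<^sup>2 + 2 * (v x - v y)\<^sup>2"
      using power2_add_le[of "u x - u y" "v x - v y"] by (simp add: algebra_simps)
    then have "ennreal ((u x + v x - (u y + v y))\<^sup>2) \<le> ennreal (2 * (u x - u y)\<^sup>2 + 2 * (v x - v y)\<^sup>2)"
      by (rule ennreal_leI)
    then show ?thesis
      by (subst (asm) ennreal_plus) (auto simp: ennreal_mult')
  qed
  have "gagliardo_energy s UNIV (\<lambda>x. u x + v x) \<le>
    (\<integral>\<^sup>+p. 2 * (ennreal ((u (fst p) - u (snd p))\<^sup>2) * riesz_kernel (2 * s) p)
       + 2 * (ennreal ((v (fst p) - v (snd p))\<^sup>2) * riesz_kernel (2 * s) p) \<partial>(lebesgue \<Otimes>\<^sub>M lebesgue))"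
    unfolding gagliardo_energy_eq
    by (intro nn_integral_mono)
       (auto intro!: mult_right_mono * simp: mult.assoc[symmetric] simp flip: distrib_right)
  also have "\<dots> = 2 * gagliardo_energy s UNIV u + 2 * gagliardo_energy s UNIV v"
    unfolding gagliardo_energy_eq by (simp add: nn_integral_add nn_integral_cmult)
  finally show ?thesis .
qed

lemma gagliardo_energy_cmult:
  fixes u :: "real ^ 'n \<Rightarrow> real"
  assumes [measurable]: "u \<in> borel_measurable lebesgue"
  shows "gagliardo_energy s UNIV (\<lambda>x. c * u x) = ennreal (c\<^sup>2) * gagliardo_energy s UNIV u"
proof -
  have "ennreal ((c * u x - c * u y)\<^sup>2) = ennreal (c\<^sup>2) * ennreal ((u x - u y)\<^sup>2)" for x y
    by (simp add: power_mult_distrib ennreal_mult' flip: right_diff_distrib)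
  then show ?thesis
    unfolding gagliardo_energy_eq by (simp add: nn_integral_cmult mult.assoc)
qed

text \<open>If the functions agree off a null set \<open>N\<close>, the differences agree off
  \<open>N \<times> UNIV \<union> UNIV \<times> N\<close>, which is null in the product. This allows
  \<open>u\<close> to be replaced by an exact sign function.\<close>

lemma gagliardo_energy_cong_AE:
  fixes u v :: "real ^ 'n \<Rightarrow> real"
  assumes "AE x in lebesgue. u x = v x"
  shows "gagliardo_energy s Q u = gagliardo_energy s Q v"
proof -
  interpret pair_sigma_finite "lebesgue :: (real^'n) measure" "lebesgue :: (real^'n) measure"
    by (rule pair_sigma_finite_lebesgue)
  from assms obtain N where N: "N \<in> null_sets lebesgue" "{x. u x \<noteq> v x} \<subseteq> N"
    by (auto elim!: AE_E2 simp: eventually_ae_filter)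
  have "N \<times> UNIV \<in> null_sets ((lebesgue :: (real^'n) measure) \<Otimes>\<^sub>M (lebesgue :: (real^'n) measure))"
    "UNIV \<times> N \<in> null_sets ((lebesgue :: (real^'n) measure) \<Otimes>\<^sub>M (lebesgue :: (real^'n) measure))"
    using N by (auto intro: times_in_null_sets1 times_in_null_sets2)
  then have "N \<times> UNIV \<union> UNIV \<times> N \<in> null_sets ((lebesgue :: (real^'n) measure) \<Otimes>\<^sub>M (lebesgue :: (real^'n) measure))"
    by auto
  then have "AE p in lebesgue \<Otimes>\<^sub>M lebesgue. u (fst p) = v (fst p) \<and> u (snd p) = v (snd p)"
    by (rule AE_I') (use N in auto)
  then have "AE p in lebesgue \<Otimes>\<^sub>M lebesgue.
      ennreal ((u (fst p) - u (snd p))\<^sup>2) * riesz_kernel (2 * s) p * indicator Q p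
    = ennreal ((v (fst p) - v (snd p))\<^sup>2) * riesz_kernel (2 * s) p * indicator Q p"
    by eventually_elim simp
  then show ?thesis
    unfolding gagliardo_energy_eq by (rule nn_integral_cong_AE)
qed

text \<open>For a competitor, the difference from the datum is that of \<open>u\<close> plus a
  multiple of the damping term; closure under sums and multiples keeps it in the space.\<close>

lemma frac_sobolev_UNIV_add:
  fixes u v :: "real ^ 'n \<Rightarrow> real"
  assumes "u \<in> frac_sobolev s UNIV" "v \<in> frac_sobolev s UNIV"
  shows "(\<lambda>x. u x + v x) \<in> frac_sobolev s UNIV"
proof -
  have [measurable]: "u \<in> borel_measurable lebesgue" "v \<in> borel_measurable lebesgue"
    and i: "integrable lebesgue (\<lambda>x. (u x)\<^sup>2)" "integrable lebesgue (\<lambda>x. (v x)\<^sup>2)"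
    and g: "gagliardo_energy s UNIV u < \<infinity>" "gagliardo_energy s UNIV v < \<infinity>"
    using assms by (auto simp: frac_sobolev_def lebesgue_on_UNIV_eq)
  have "integrable lebesgue (\<lambda>x. (u x + v x)\<^sup>2)"
  proof (rule Bochner_Integration.integrable_bound)
    show "integrable lebesgue (\<lambda>x. 2 * (u x)\<^sup>2 + 2 * (v x)\<^sup>2)"
      using i by auto
    show "AE x in lebesgue. norm ((u x + v x)\<^sup>2) \<le> norm (2 * (u x)\<^sup>2 + 2 * (v x)\<^sup>2)"
      using power2_add_le by auto
  qed measurable
  moreover have "gagliardo_energy s UNIV (\<lambda>x. u x + v x) < \<infinity>"
    by (rule le_less_trans[OF gagliardo_energy_add_le]) (use g in \<open>auto simp: ennreal_mult_less_top\<close>)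
  ultimately show ?thesis
    by (simp add: frac_sobolev_def lebesgue_on_UNIV_eq)
qed

lemma frac_sobolev_UNIV_cmult:
  fixes u :: "real ^ 'n \<Rightarrow> real"
  assumes "u \<in> frac_sobolev s UNIV"
  shows "(\<lambda>x. c * u x) \<in> frac_sobolev s UNIV"
proof -
  have [measurable]: "u \<in> borel_measurable lebesgue"
    and i: "integrable lebesgue (\<lambda>x. (u x)\<^sup>2)" and g: "gagliardo_energy s UNIV u < \<infinity>"
    using assms by (auto simp: frac_sobolev_def lebesgue_on_UNIV_eq)
  have "integrable lebesgue (\<lambda>x. (c * u x)\<^sup>2)"
    unfolding power_mult_distrib using i by (rule integrable_mult_right)
  moreover have "gagliardo_energy s UNIV (\<lambda>x. c * u x) < \<infinity>"
    using g by (simp only: gagliardo_energy_cmult[OF \<open>u \<in> borel_measurable lebesgue\<close>] ennreal_mult_less_top infinity_ennreal_def) auto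
  moreover have "(\<lambda>x. c * u x) \<in> borel_measurable lebesgue"
    by measurable
  ultimately show ?thesis
    by (simp add: frac_sobolev_def lebesgue_on_UNIV_eq)
qed

section \<open>Uniform integrability of the truncated kernel\<close>

lemma summable_ennreal_geometric:
  assumes "0 \<le> c" "0 < q" "q < 1"
  shows "(\<Sum>k. ennreal (c * q ^ k)) < \<infinity>"
proof -
  have "summable (\<lambda>k. c * q ^ k)"
    using assms by (intro summable_mult summable_geometric) auto
  then show ?thesis
    using assms by (subst suminf_ennreal2) auto
qed

text \<open>The distance lies in one dyadic shell from \<open>2 powr m\<close> to
  \<open>2 powr (m + 1)\<close>, so a single term of the series already dominates. For far shells
  the truncation is bounded by 1, for near shells by the squared distance. Whole balls replace the
  shells because their volumes are explicit.\<close>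

lemma truncated_riesz_kernel_le_dyadic:
  fixes x y :: "real ^ 'n"
  assumes r: "0 < r"
  defines "N \<equiv> real CARD('n)"
  shows "ennreal (min 1 ((norm (x - y))\<^sup>2)) * riesz_kernel r (x, y)
    \<le> (\<Sum>k. ennreal (2 powr ((N + r) * (real k + 1) - 2 * real k)) * indicator (cball x (2 powr - real k)) y
          + ennreal (2 powr (- real k * (N + r))) * indicator (cball x (2 powr (real k + 1))) y)"
    (is "?l \<le> (\<Sum>k. ?a k + ?b k)")
proof (cases "x = y")
  case False
  define z where "z = norm (x - y)"
  have z: "z > 0" using False by (simp add: z_def)
  have Nr: "N + r > 0" using r by (simp add: N_def add_nonneg_pos)
  have l: "?l = ennreal (min 1 (z\<^sup>2) / z powr (N + r))"
    by (simp add: riesz_kernel_def z_def N_def flip: ennreal_mult')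
  have pt: "?a k + ?b k \<le> (\<Sum>k. ?a k + ?b k)" for k
    using sum_le_suminf[of "\<lambda>k. ?a k + ?b k" "{k}"] by simp
  define m where "m = \<lfloor>log 2 z\<rfloor>"
  have m: "2 powr m \<le> z" "z < 2 powr (m + 1)"
    using z unfolding m_def by (simp_all add: powr_le_iff le_log_iff less_powr_iff log_less_iff)
  show ?thesis
  proof (cases "m \<ge> 0")
    case True
    define k where "k = nat m"
    have k: "real_of_int m = real k" using True by (simp add: k_def)
    have "min 1 (z\<^sup>2) / z powr (N + r) \<le> 1 / (2 powr real k) powr (N + r)"
      using m z Nr by (intro frac_le powr_mono2) (auto simp: k)
    also have "\<dots> = 2 powr (- real k * (N + r))"
      by (simp add: powr_powr powr_minus_divide)
    finally have "?l \<le> ?b k"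
      using m(2) by (simp add: l k dist_norm z_def indicator_def ennreal_leI)
    also have "\<dots> \<le> ?a k + ?b k" by simp
    finally show ?thesis using pt[of k] by (rule order_trans)
  next
    case False
    \<comment> \<open>The shift makes \<open>2 powr - real k\<close> equal to
      \<open>2 powr (m + 1)\<close>, the upper end of the shell; the near shells start with
      \<open>m = -1\<close> at \<open>k = 0\<close>.\<close>
    define k where "k = nat (- m - 1)"
    have k: "real_of_int m = - real k - 1" using False by (simp add: k_def)
    have "min 1 (z\<^sup>2) / z powr (N + r) \<le> (2 powr - real k)\<^sup>2 / (2 powr (- real k - 1)) powr (N + r)"
      using m z Nr by (intro frac_le powr_mono2 min.coboundedI2 power_mono) (auto simp: k)
    also have "\<dots> = 2 powr ((N + r) * (real k + 1) - 2 * real k)"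
    proof -
      have "(2 powr - real k)\<^sup>2 = 2 powr (- 2 * real k)"
        by (simp add: powr_power)
      then show ?thesis
        by (simp only: powr_powr powr_diff[symmetric]) (simp add: algebra_simps)
    qed
    finally have "?l \<le> ?a k"
      using m(2) by (simp add: l k dist_norm z_def indicator_def ennreal_leI)
    also have "\<dots> \<le> ?a k + ?b k" by simp
    finally show ?thesis using pt[of k] by (rule order_trans)
  qed
qed simp

text \<open>Integrating the dyadic bound gives two geometric series. The near one has ratio
  \<open>2 powr (r - 2)\<close> and needs \<open>r < 2\<close>; the far one has ratio
  \<open>2 powr (- r)\<close> and needs \<open>0 < r\<close>. The volume of a ball does not depend
  on its centre, hence neither does the bound.\<close>

lemma truncated_riesz_kernel_integral_bound:
  assumes r: "0 < r" "r < 2"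
  shows "\<exists>C<\<infinity>. \<forall>x :: real ^ 'n.
    (\<integral>\<^sup>+y. ennreal (min 1 ((norm (x - y))\<^sup>2)) * riesz_kernel r (x, y) \<partial>lebesgue) \<le> C"
proof -
  define N where "N = real CARD('n)"
  define V where "V = unit_ball_vol N"
  have V: "V \<ge> 0" by (simp add: V_def N_def)
  define a where "a k = 2 powr ((N + r) * (real k + 1) - 2 * real k)" for k
  define b where "b k = 2 powr (- real k * (N + r))" for k
  define C where "C = (\<Sum>k. ennreal ((V * 2 powr (N + r)) * (2 powr (r - 2)) ^ k))
     + (\<Sum>k. ennreal ((V * 2 powr N) * (2 powr (- r)) ^ k))"
  have "C < \<infinity>"
    unfolding C_def infinity_ennreal_def ennreal_add_less_top
    using r V by (intro conjI summable_ennreal_geometric[unfolded infinity_ennreal_def])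
      (auto intro: powr_less_one)
  moreover have "(\<integral>\<^sup>+y. ennreal (min 1 ((norm (x - y))\<^sup>2)) * riesz_kernel r (x, y) \<partial>lebesgue) \<le> C"
    for x :: "real ^ 'n"
  proof -
    have cb: "emeasure lebesgue (cball x \<rho>) = ennreal (V * \<rho> powr N)" if "\<rho> > 0" for \<rho>
      using that by (simp add: emeasure_cball V_def N_def powr_realpow)
    have [measurable]: "cball x \<rho> \<in> sets lebesgue" for \<rho>
      by simp
    have "(\<integral>\<^sup>+y. ennreal (min 1 ((norm (x - y))\<^sup>2)) * riesz_kernel r (x, y) \<partial>lebesgue)
      \<le> (\<integral>\<^sup>+y. (\<Sum>k. ennreal (a k) * indicator (cball x (2 powr - real k)) y
          + ennreal (b k) * indicator (cball x (2 powr (real k + 1))) y) \<partial>lebesgue)"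
      unfolding a_def b_def N_def by (intro nn_integral_mono truncated_riesz_kernel_le_dyadic r)
    also have "\<dots> = (\<Sum>k. ennreal (a k) * emeasure lebesgue (cball x (2 powr - real k))
          + ennreal (b k) * emeasure lebesgue (cball x (2 powr (real k + 1))))"
    proof (subst nn_integral_suminf)
      show "(\<Sum>k. \<integral>\<^sup>+y. ennreal (a k) * indicator (cball x (2 powr - real k)) y
          + ennreal (b k) * indicator (cball x (2 powr (real k + 1))) y \<partial>lebesgue)
        = (\<Sum>k. ennreal (a k) * emeasure lebesgue (cball x (2 powr - real k))
          + ennreal (b k) * emeasure lebesgue (cball x (2 powr (real k + 1))))"
      proof (rule suminf_cong)
        show "(\<integral>\<^sup>+y. ennreal (a k) * indicator (cball x (2 powr - real k)) y
            + ennreal (b k) * indicator (cball x (2 powr (real k + 1))) y \<partial>lebesgue)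
          = ennreal (a k) * emeasure lebesgue (cball x (2 powr - real k))
            + ennreal (b k) * emeasure lebesgue (cball x (2 powr (real k + 1)))" for k
          by (subst nn_integral_add) (simp_all add: nn_integral_cmult_indicator del: emeasure_completion)
      qed
    qed measurable
    also have "\<dots> = (\<Sum>k. ennreal (V * 2 powr (N + r) * (2 powr (r - 2)) ^ k)
        + ennreal (V * 2 powr N * (2 powr - r) ^ k))"
    proof (intro suminf_cong arg_cong2[where f = "(+)"])
      fix k
      \<comment> \<open>The volume adds \<open>- k * N\<close> to the exponent, leaving
        \<open>N + r + k * (r - 2)\<close>. For \<open>b\<close> it adds \<open>(k + 1) * N\<close>,
        leaving \<open>N - k * r\<close>.\<close>
      have "a k * (2 powr - real k) powr N = 2 powr (N + r) * (2 powr (r - 2)) ^ k"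
        by (simp add: a_def powr_powr powr_power algebra_simps flip: powr_add)
      then show "ennreal (a k) * emeasure lebesgue (cball x (2 powr - real k))
        = ennreal (V * 2 powr (N + r) * (2 powr (r - 2)) ^ k)"
        using V by (subst cb) (auto simp: a_def ac_simps simp flip: ennreal_mult)
      have "b k * (2 powr (real k + 1)) powr N = 2 powr N * (2 powr - r) ^ k"
        by (simp add: b_def powr_powr powr_power algebra_simps flip: powr_add)
      then show "ennreal (b k) * emeasure lebesgue (cball x (2 powr (real k + 1)))
        = ennreal (V * 2 powr N * (2 powr - r) ^ k)"
        using V by (subst cb) (auto simp: b_def ac_simps simp flip: ennreal_mult)
    qed
    also have "\<dots> = C"
      unfolding C_def by (rule suminf_add[symmetric]) auto
    finally show ?thesis .
  qed
  ultimately show ?thesis by blast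
qed

section \<open>A Lipschitz cutoff on the unit ball and multiplication by it\<close>

definition cone_cutoff :: "real ^ 'n \<Rightarrow> real" where
  "cone_cutoff x = max 0 (1 - norm x)"

lemma borel_measurable_cone_cutoff [measurable]: "cone_cutoff \<in> borel_measurable lebesgue"
  unfolding cone_cutoff_def[abs_def] by (intro measurable_completion) auto

text \<open>Positivity on the whole open ball lets a vanishing weighted integral control every pair
  with at least one point there.\<close>

lemma cone_cutoff_pos_iff: "0 < cone_cutoff x \<longleftrightarrow> x \<in> ball 0 1"
  by (auto simp: cone_cutoff_def)

lemma cone_cutoff_bounds: "0 \<le> cone_cutoff x" "cone_cutoff x \<le> 1"
  by (auto simp: cone_cutoff_def)

lemma cone_cutoff_eq_0_iff: "cone_cutoff x = 0 \<longleftrightarrow> x \<notin> ball 0 1"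
  by (auto simp: cone_cutoff_def)

text \<open>The cutoff is 1-Lipschitz with values in [0, 1], so its squared difference is at most
  \<open>min 1 ((norm (x - y))\<^sup>2)\<close>, and it vanishes unless one of the points lies in
  the ball. The uniform kernel bound is then integrated over that ball, which has finite
  measure.\<close>

lemma gagliardo_energy_cone_cutoff_finite:
  assumes s: "0 < s" "s < 1"
  shows "gagliardo_energy s UNIV (cone_cutoff :: real ^ 'n \<Rightarrow> real) < \<infinity>"
proof -
  interpret pair_sigma_finite "lebesgue :: (real^'n) measure" "lebesgue :: (real^'n) measure"
    by (rule pair_sigma_finite_lebesgue)
  let ?B = "ball 0 1 :: (real^'n) set"
  define g :: "(real^'n) \<times> (real^'n) \<Rightarrow> ennreal"
    where "g p = ennreal (min 1 ((norm (fst p - snd p))\<^sup>2)) * riesz_kernel (2 * s) p" for p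
  have [measurable]: "?B \<in> sets lebesgue" by simp
  have gm [measurable]: "g \<in> borel_measurable (lebesgue \<Otimes>\<^sub>M lebesgue)"
    unfolding g_def[abs_def] by measurable
  obtain C where C: "C < \<infinity>" "\<And>x. (\<integral>\<^sup>+y. g (x, y) \<partial>lebesgue) \<le> C"
    using truncated_riesz_kernel_integral_bound[of "2 * s", where 'n = 'n] s by (auto simp: g_def)
  have g_commute: "g (x, y) = g (y, x)" for x y
    by (simp add: g_def riesz_kernel_def norm_minus_commute)
  have C_bound: "(\<integral>\<^sup>+x. (\<integral>\<^sup>+y. g (x, y) \<partial>lebesgue) * indicator ?B x \<partial>lebesgue) \<le> C * emeasure lebesgue ?B"
  proof -
    have "(\<integral>\<^sup>+x. (\<integral>\<^sup>+y. g (x, y) \<partial>lebesgue) * indicator ?B x \<partial>lebesgue)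
        \<le> (\<integral>\<^sup>+x. C * indicator ?B x \<partial>lebesgue)"
      by (intro nn_integral_mono mult_right_mono C(2)) simp
    also have "\<dots> = C * emeasure lebesgue ?B"
      by (rule nn_integral_cmult_indicator) measurable
    finally show ?thesis .
  qed
  have gm1: "(\<lambda>(x, y). g (x, y) * indicator ?B x) \<in> borel_measurable (lebesgue \<Otimes>\<^sub>M lebesgue)"
    and gm2: "(\<lambda>(x, y). g (x, y) * indicator ?B y) \<in> borel_measurable (lebesgue \<Otimes>\<^sub>M lebesgue)"
    unfolding case_prod_beta' by measurable
  have pt: "ennreal ((cone_cutoff (fst p) - cone_cutoff (snd p))\<^sup>2) * riesz_kernel (2 * s) p
      \<le> g p * indicator ?B (fst p) + g p * indicator ?B (snd p)" for p
  proof (cases "fst p \<in> ?B \<or> snd p \<in> ?B")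
    case True
    have "\<bar>cone_cutoff (fst p) - cone_cutoff (snd p)\<bar> \<le> norm (fst p - snd p)"
      using norm_triangle_ineq3[of "fst p" "snd p"] unfolding cone_cutoff_def by linarith
    moreover have "\<bar>cone_cutoff (fst p) - cone_cutoff (snd p)\<bar> \<le> 1"
      using cone_cutoff_bounds[of "fst p"] cone_cutoff_bounds[of "snd p"] by linarith
    ultimately have "(cone_cutoff (fst p) - cone_cutoff (snd p))\<^sup>2 \<le> min 1 ((norm (fst p - snd p))\<^sup>2)"
      by (simp add: abs_square_le_1 abs_le_square_iff[symmetric])
    then have "ennreal ((cone_cutoff (fst p) - cone_cutoff (snd p))\<^sup>2) * riesz_kernel (2 * s) p \<le> g p"
      unfolding g_def by (intro mult_right_mono ennreal_leI) auto
    also have "\<dots> \<le> g p * indicator ?B (fst p) + g p * indicator ?B (snd p)"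
      using True by (auto simp: indicator_def)
    finally show ?thesis .
  next
    case False
    then have "cone_cutoff (fst p) = 0" "cone_cutoff (snd p) = 0"
      by (simp_all add: cone_cutoff_eq_0_iff)
    then show ?thesis by simp
  qed
  have fst_eq: "(\<integral>\<^sup>+p. g p * indicator ?B (fst p) \<partial>(lebesgue \<Otimes>\<^sub>M lebesgue))
      = (\<integral>\<^sup>+x. (\<integral>\<^sup>+y. g (x, y) \<partial>lebesgue) * indicator ?B x \<partial>lebesgue)"
  proof -
    have "(\<integral>\<^sup>+p. g p * indicator ?B (fst p) \<partial>(lebesgue \<Otimes>\<^sub>M lebesgue))
      = (\<integral>\<^sup>+x. (\<integral>\<^sup>+y. g (x, y) * indicator ?B x \<partial>lebesgue) \<partial>lebesgue)"
      using sigma_finite_measure.nn_integral_fst[OF sigma_finite_lebesgue gm1] by (simp add: case_prod_beta')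
    also have "\<dots> = (\<integral>\<^sup>+x. (\<integral>\<^sup>+y. g (x, y) \<partial>lebesgue) * indicator ?B x \<partial>lebesgue)"
      by (intro nn_integral_cong nn_integral_multc) measurable
    finally show ?thesis .
  qed
  \<comment> \<open>Integrating in the other order and using the symmetry of \<open>g\<close> gives
    the same iterated integral, so \<open>C_bound\<close> covers both terms.\<close>
  have snd_eq: "(\<integral>\<^sup>+p. g p * indicator ?B (snd p) \<partial>(lebesgue \<Otimes>\<^sub>M lebesgue))
      = (\<integral>\<^sup>+y. (\<integral>\<^sup>+x. g (y, x) \<partial>lebesgue) * indicator ?B y \<partial>lebesgue)"
  proof -
    have "(\<integral>\<^sup>+p. g p * indicator ?B (snd p) \<partial>(lebesgue \<Otimes>\<^sub>M lebesgue))
        = (\<integral>\<^sup>+y. (\<integral>\<^sup>+x. g (x, y) * indicator ?B y \<partial>lebesgue) \<partial>lebesgue)"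
      using nn_integral_snd[OF gm2] by (simp add: case_prod_beta')
    also have "\<dots> = (\<integral>\<^sup>+y. (\<integral>\<^sup>+x. g (y, x) * indicator ?B y \<partial>lebesgue) \<partial>lebesgue)"
      by (intro nn_integral_cong arg_cong2[where f = "(*)"] g_commute refl)
    also have "\<dots> = (\<integral>\<^sup>+y. (\<integral>\<^sup>+x. g (y, x) \<partial>lebesgue) * indicator ?B y \<partial>lebesgue)"
      by (intro nn_integral_cong nn_integral_multc) measurable
    finally show ?thesis .
  qed
  have "gagliardo_energy s UNIV (cone_cutoff :: real ^ 'n \<Rightarrow> real)
    \<le> (\<integral>\<^sup>+p. g p * indicator ?B (fst p) + g p * indicator ?B (snd p) \<partial>(lebesgue \<Otimes>\<^sub>M lebesgue))"
    unfolding gagliardo_energy_eq using pt by (intro nn_integral_mono) simp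
  also have "\<dots> = (\<integral>\<^sup>+p. g p * indicator ?B (fst p) \<partial>(lebesgue \<Otimes>\<^sub>M lebesgue))
      + (\<integral>\<^sup>+p. g p * indicator ?B (snd p) \<partial>(lebesgue \<Otimes>\<^sub>M lebesgue))"
    by (rule nn_integral_add) measurable
  also have "\<dots> \<le> C * emeasure lebesgue ?B + C * emeasure lebesgue ?B"
    unfolding fst_eq snd_eq by (intro add_mono C_bound)
  also have "\<dots> < \<infinity>"
    using C(1) by (simp add: ennreal_mult_less_top emeasure_ball)
  finally show ?thesis .
qed

lemma sets_cross_domain [measurable]:
  fixes \<Omega> :: "(real ^ 'n) set"
  assumes [measurable]: "\<Omega> \<in> sets lebesgue"
  shows "UNIV - (- \<Omega>) \<times> (- \<Omega>) \<in> sets (lebesgue \<Otimes>\<^sub>M lebesgue)"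
proof -
  have [measurable]: "- \<Omega> \<in> sets lebesgue"
    using assms by (auto simp: Compl_eq_Diff_UNIV)
  have "space ((lebesgue :: (real^'n) measure) \<Otimes>\<^sub>M (lebesgue :: (real^'n) measure)) - (- \<Omega>) \<times> (- \<Omega>)
      \<in> sets (lebesgue \<Otimes>\<^sub>M lebesgue)"
    by measurable
  then show ?thesis by (simp add: space_pair_measure)
qed

text \<open>The difference of the products is
  \<open>(\<eta> x - \<eta> y) * w x + \<eta> y * (w x - w y)\<close>, with \<open>\<eta>\<close>
  the cutoff. The first part is controlled by the energy of the cutoff, since \<open>w\<close> is
  bounded by 1. The second vanishes unless \<open>y\<close> is in the ball, so the energy of
  \<open>w\<close> is needed only on pairs meeting the ball.\<close>

lemma cone_cutoff_mult_in_frac_sobolev: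
  fixes w :: "real ^ 'n \<Rightarrow> real"
  assumes s: "0 < s" "s < 1" and w [measurable]: "w \<in> borel_measurable lebesgue"
    and w_le: "\<And>x. \<bar>w x\<bar> \<le> 1"
    and fin: "gagliardo_energy s (UNIV - (- ball 0 1) \<times> (- ball 0 1)) w < \<infinity>"
  shows "(\<lambda>x. cone_cutoff x * w x) \<in> frac_sobolev s UNIV"
proof -
  let ?Q = "UNIV - (- ball 0 1) \<times> (- ball 0 1) :: ((real^'n) \<times> (real^'n)) set"
  let ?K = "riesz_kernel (2 * s) :: (real^'n) \<times> (real^'n) \<Rightarrow> ennreal"
  have [measurable]: "ball 0 1 \<in> sets (lebesgue :: (real^'n) measure)" by simp
  have [measurable]: "?Q \<in> sets (lebesgue \<Otimes>\<^sub>M lebesgue)"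
    by (rule sets_cross_domain) simp
  have le_1: "\<bar>cone_cutoff x * w x\<bar> \<le> 1" for x
    using cone_cutoff_bounds[of x] w_le[of x] by (auto simp: abs_mult intro!: mult_le_one)
  have "integrable lebesgue (\<lambda>x. (cone_cutoff x * w x)\<^sup>2)"
  proof (rule Bochner_Integration.integrable_bound)
    show "integrable lebesgue (indicator (ball 0 1) :: real^'n \<Rightarrow> real)"
      by (simp add: integrable_indicator_iff emeasure_ball)
    show "AE x in lebesgue. norm ((cone_cutoff x * w x)\<^sup>2) \<le> norm (indicator (ball 0 1) x :: real)"
    proof (intro AE_I2)
      fix x :: "real^'n"
      show "norm ((cone_cutoff x * w x)\<^sup>2) \<le> norm (indicator (ball 0 1) x :: real)"
      proof (cases "x \<in> ball 0 1")
        case True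
        then show ?thesis using le_1[of x] by (simp add: abs_square_le_1)
      next
        case False
        then have "cone_cutoff x = 0" by (simp add: cone_cutoff_eq_0_iff)
        then show ?thesis by simp
      qed
    qed
  qed measurable
  moreover have "gagliardo_energy s UNIV (\<lambda>x. cone_cutoff x * w x) < \<infinity>"
  proof -
    have pt: "(cone_cutoff x * w x - cone_cutoff y * w y)\<^sup>2
        \<le> 2 * (cone_cutoff x - cone_cutoff y)\<^sup>2 + 2 * ((w x - w y)\<^sup>2 * indicator ?Q (x, y))" for x y
    proof -
      have "(cone_cutoff x * w x - cone_cutoff y * w y)\<^sup>2
          = ((cone_cutoff x - cone_cutoff y) * w x + cone_cutoff y * (w x - w y))\<^sup>2"
        by (simp add: algebra_simps)
      also have "\<dots> \<le> 2 * ((cone_cutoff x - cone_cutoff y) * w x)\<^sup>2 + 2 * (cone_cutoff y * (w x - w y))\<^sup>2"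
        by (rule power2_add_le)
      also have "((cone_cutoff x - cone_cutoff y) * w x)\<^sup>2 \<le> (cone_cutoff x - cone_cutoff y)\<^sup>2"
        using w_le[of x] by (simp add: power_mult_distrib mult_left_le abs_square_le_1)
      also have "(cone_cutoff y * (w x - w y))\<^sup>2 \<le> (w x - w y)\<^sup>2 * indicator ?Q (x, y)"
      proof (cases "y \<in> ball 0 1")
        case True
        have "(cone_cutoff y)\<^sup>2 \<le> 1"
          using cone_cutoff_bounds[of y] by (simp add: abs_square_le_1)
        then show ?thesis
          using True by (simp add: power_mult_distrib mult_left_le_one_le)
      next
        case False
        then have "cone_cutoff y = 0" by (simp add: cone_cutoff_eq_0_iff)
        then show ?thesis by simp
      qed
      finally show ?thesis by simp
    qed
    have pt': "ennreal ((cone_cutoff (fst p) * w (fst p) - cone_cutoff (snd p) * w (snd p))\<^sup>2) * ?K p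
      \<le> 2 * (ennreal ((cone_cutoff (fst p) - cone_cutoff (snd p))\<^sup>2) * ?K p)
         + 2 * (ennreal ((w (fst p) - w (snd p))\<^sup>2) * ?K p * indicator ?Q p)" for p
    proof -
      have "ennreal ((cone_cutoff (fst p) * w (fst p) - cone_cutoff (snd p) * w (snd p))\<^sup>2)
        \<le> ennreal (2 * (cone_cutoff (fst p) - cone_cutoff (snd p))\<^sup>2
            + 2 * ((w (fst p) - w (snd p))\<^sup>2 * indicator ?Q p))"
        using pt[of "fst p" "snd p"] by (intro ennreal_leI) simp
      also have "\<dots> = 2 * ennreal ((cone_cutoff (fst p) - cone_cutoff (snd p))\<^sup>2)
            + 2 * (ennreal ((w (fst p) - w (snd p))\<^sup>2) * indicator ?Q p)"
        by (subst ennreal_plus) (auto simp: ennreal_mult' indicator_def)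
      finally have "ennreal ((cone_cutoff (fst p) * w (fst p) - cone_cutoff (snd p) * w (snd p))\<^sup>2) * ?K p
        \<le> (2 * ennreal ((cone_cutoff (fst p) - cone_cutoff (snd p))\<^sup>2)
            + 2 * (ennreal ((w (fst p) - w (snd p))\<^sup>2) * indicator ?Q p)) * ?K p"
        by (rule mult_right_mono) simp
      then show ?thesis by (simp only: distrib_right distrib_left ac_simps)
    qed
    have "gagliardo_energy s UNIV (\<lambda>x. cone_cutoff x * w x)
      \<le> (\<integral>\<^sup>+p. 2 * (ennreal ((cone_cutoff (fst p) - cone_cutoff (snd p))\<^sup>2) * ?K p)
         + 2 * (ennreal ((w (fst p) - w (snd p))\<^sup>2) * ?K p * indicator ?Q p) \<partial>(lebesgue \<Otimes>\<^sub>M lebesgue))"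
      unfolding gagliardo_energy_eq using pt' by (intro nn_integral_mono) simp
    also have "\<dots> = 2 * gagliardo_energy s UNIV (cone_cutoff :: real^'n \<Rightarrow> real) + 2 * gagliardo_energy s ?Q w"
      unfolding gagliardo_energy_eq
      by (simp add: nn_integral_add nn_integral_cmult)
    also have "\<dots> < \<infinity>"
      using fin gagliardo_energy_cone_cutoff_finite[OF s, where 'n = 'n]
      by (simp add: ennreal_mult_less_top)
    finally show ?thesis .
  qed
  ultimately show ?thesis
    by (simp add: frac_sobolev_def lebesgue_on_UNIV_eq)
qed

section \<open>First variation of the energy under damping\<close>

lemma gagliardo_energy_damped_sign_function:
  fixes E :: "(real ^ 'n) set" and \<eta> :: "real ^ 'n \<Rightarrow> real"
  assumes [measurable]: "E \<in> sets lebesgue" "\<eta> \<in> borel_measurable lebesgue"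
      "Q \<in> sets (lebesgue \<Otimes>\<^sub>M lebesgue)"
    and \<eta>: "\<And>x. 0 \<le> \<eta> x" and t: "0 \<le> t"
  defines "w \<equiv> \<lambda>x. indicator E x - indicator (- E) x"
  shows "gagliardo_energy s Q (\<lambda>x. w x - t * (\<eta> x * w x))
      + ennreal (4 * t) * (\<integral>\<^sup>+p. ennreal (\<eta> (fst p) + \<eta> (snd p)) * indicator (E \<times> (- E) \<union> (- E) \<times> E) p
          * riesz_kernel (2 * s) p * indicator Q p \<partial>(lebesgue \<Otimes>\<^sub>M lebesgue))
    = gagliardo_energy s Q w + ennreal (t\<^sup>2) * gagliardo_energy s Q (\<lambda>x. \<eta> x * w x)"
proof -
  let ?K = "riesz_kernel (2 * s) :: (real^'n) \<times> (real^'n) \<Rightarrow> ennreal"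
  let ?D = "E \<times> (- E) \<union> (- E) \<times> E"
  have [measurable]: "- E \<in> sets lebesgue"
    using assms by (auto simp: Compl_eq_Diff_UNIV)
  have [measurable]: "w \<in> borel_measurable lebesgue"
    unfolding w_def by measurable
  \<comment> \<open>On one side of \<open>E\<close> both squares reduce to
    \<open>t\<^sup>2 * (\<eta> x - \<eta> y)\<^sup>2\<close>. On opposite sides, with
    \<open>a = \<eta> x + \<eta> y\<close>, this is
    \<open>(2 - t * a)\<^sup>2 + 4 * t * a = 4 + t\<^sup>2 * a\<^sup>2\<close>. The cross term
    stands on the left, so that no subtraction of possibly infinite integrals occurs.\<close>
  have pt: "(w x - t * (\<eta> x * w x) - (w y - t * (\<eta> y * w y)))\<^sup>2
      + 4 * t * ((\<eta> x + \<eta> y) * indicator ?D (x, y))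
    = (w x - w y)\<^sup>2 + t\<^sup>2 * (\<eta> x * w x - \<eta> y * w y)\<^sup>2" for x y
    by (cases "x \<in> E"; cases "y \<in> E") (simp_all add: w_def power2_eq_square algebra_simps)
  have pt': "ennreal ((w (fst p) - t * (\<eta> (fst p) * w (fst p)) - (w (snd p) - t * (\<eta> (snd p) * w (snd p))))\<^sup>2) * ?K p * indicator Q p
      + ennreal (4 * t) * (ennreal (\<eta> (fst p) + \<eta> (snd p)) * indicator ?D p * ?K p * indicator Q p)
    = ennreal ((w (fst p) - w (snd p))\<^sup>2) * ?K p * indicator Q p
      + ennreal (t\<^sup>2) * (ennreal ((\<eta> (fst p) * w (fst p) - \<eta> (snd p) * w (snd p))\<^sup>2) * ?K p * indicator Q p)"
    (is "?a * ?K p * ?q + ?b * (?c * ?d * ?K p * ?q) = ?e * ?K p * ?q + ?f * (?g * ?K p * ?q)") for p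
  proof -
    have "?a + ?b * (?c * ?d) = ?e + ?f * ?g"
    proof -
      have "?b * (?c * ?d) = ennreal (4 * t * ((\<eta> (fst p) + \<eta> (snd p)) * indicator ?D p))"
        using t \<eta> by (auto simp: indicator_def ennreal_mult)
      moreover have "?f * ?g = ennreal (t\<^sup>2 * (\<eta> (fst p) * w (fst p) - \<eta> (snd p) * w (snd p))\<^sup>2)"
        by (simp add: ennreal_mult)
      ultimately show ?thesis
        using pt[of "fst p" "snd p"] t \<eta> by (simp flip: ennreal_plus)
    qed
    then have "(?a + ?b * (?c * ?d)) * (?K p * ?q) = (?e + ?f * ?g) * (?K p * ?q)"
      by (rule arg_cong)
    then show ?thesis by (simp only: distrib_right mult.assoc)
  qed
  have lin: "(\<integral>\<^sup>+p. f p + c * h p \<partial>M) = (\<integral>\<^sup>+p. f p \<partial>M) + c * (\<integral>\<^sup>+p. h p \<partial>M)"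
    if "f \<in> borel_measurable M" "h \<in> borel_measurable M"
    for f h :: "(real^'n) \<times> (real^'n) \<Rightarrow> ennreal" and c M
    using that by (simp add: nn_integral_add nn_integral_cmult)
  have m1: "(\<lambda>p. ennreal ((v (fst p) - v (snd p))\<^sup>2) * ?K p * indicator Q p) \<in> borel_measurable (lebesgue \<Otimes>\<^sub>M lebesgue)"
    if [measurable]: "v \<in> borel_measurable lebesgue" for v
    by measurable
  have m2: "(\<lambda>p. ennreal (\<eta> (fst p) + \<eta> (snd p)) * indicator ?D p * ?K p * indicator Q p)
      \<in> borel_measurable (lebesgue \<Otimes>\<^sub>M lebesgue)"
    by measurable
  have v1: "(\<lambda>x. w x - t * (\<eta> x * w x)) \<in> borel_measurable lebesgue"
    and v2: "(\<lambda>x. \<eta> x * w x) \<in> borel_measurable lebesgue"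
    by measurable
  show ?thesis
    unfolding gagliardo_energy_eq lin[OF m1[OF v1] m2, symmetric]
      lin[OF m1[OF \<open>w \<in> borel_measurable lebesgue\<close>] m1[OF v2], symmetric]
    by (rule nn_integral_cong) (rule pt')
qed

text \<open>Dividing by \<open>t\<close> and letting it tend to 0 would force \<open>J = 0\<close>.
  Here \<open>t = 1\<close> first shows that \<open>J\<close> is finite, and then one small real
  \<open>t\<close> suffices.\<close>

lemma ennreal_eq_0_if_quadratic_bound:
  fixes J B :: ennreal
  assumes B: "B < \<infinity>"
    and le: "\<And>t. 0 < t \<Longrightarrow> t \<le> 1 \<Longrightarrow> ennreal (4 * t) * J \<le> ennreal (t\<^sup>2) * B"
  shows "J = 0"
proof -
  obtain b where b: "B = ennreal b" "b \<ge> 0"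
    using B by (cases B) auto
  have "4 * J \<le> B"
    using le[of 1] by simp
  then have "J < \<infinity>"
    using B by (auto simp: less_top[symmetric] top_unique)
  then obtain j where j: "J = ennreal j" "j \<ge> 0"
    by (cases J) auto
  have real_le: "4 * t * j \<le> t\<^sup>2 * b" if "0 < t" "t \<le> 1" for t
    using le[OF that] b j that by (simp add: ennreal_mult[symmetric])
  have "j = 0"
  proof (rule ccontr)
    assume "j \<noteq> 0"
    with j have "j > 0" by simp
    \<comment> \<open>Chosen so that \<open>t * b \<le> t * (b + 1) = j\<close>, against
      \<open>4 * j \<le> t * b\<close>. The bound \<open>4 * j \<le> b\<close> ensures
      \<open>t \<le> 1\<close>, and the added 1 keeps the denominator positive.\<close>
    define t where "t = j / (b + 1)"
    have "4 * j \<le> b" using real_le[of 1] by simp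
    then have t: "0 < t" "t \<le> 1"
      using \<open>j > 0\<close> b by (auto simp: t_def field_simps)
    have "4 * j \<le> t * b"
      using real_le[OF t] t by (simp add: power2_eq_square)
    also have "\<dots> \<le> t * (b + 1)" using t by (simp add: algebra_simps)
    also have "\<dots> = j" using b by (simp add: t_def)
    finally show False using \<open>j > 0\<close> by simp
  qed
  then show ?thesis using j by simp
qed

section \<open>Minimality makes the pairs across \<open>E\<close> that meet the ball a null
  set\<close>

theorem mainTheorem5:
  fixes s \<sigma> :: real
    and E\<^sub>0 E :: "(real ^ 'n) set"
    and u\<^sub>0 u :: "real ^ 'n \<Rightarrow> real"
  assumes "0 < s" and "s < 1 / 2" and "\<sigma> = 2 * s"
    and "E\<^sub>0 \<in> sets lebesgue"
    and "locally_finite_perimeter \<sigma> E\<^sub>0"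
    and "u\<^sub>0 = (\<lambda>x. indicator E\<^sub>0 x - indicator (- E\<^sub>0) x)"
    and "minimizing_pair s \<sigma> (ball 0 1) u\<^sub>0 E\<^sub>0 u E"
  shows "\<not> (AE x in lebesgue. u x = indicator E x - indicator (- E) x)
         \<or> negligible (- E) \<or> negligible E"
proof (rule disjCI)
  assume "\<not> (negligible (- E) \<or> negligible E)"
  show "\<not> (AE x in lebesgue. u x = indicator E x - indicator (- E) x)"
  proof
    \<comment> \<open>\<open>u\<close> is a sign function only almost everywhere; \<open>w\<close>
      is its exact version, to which the pointwise bounds and identities apply.\<close>
    define w :: "real ^ 'n \<Rightarrow> real" where "w x = indicator E x - indicator (- E) x" for x
    assume "AE x in lebesgue. u x = indicator E x - indicator (- E) x"
    then have uw: "AE x in lebesgue. u x = w x" by (simp add: w_def)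
    interpret pair_sigma_finite "lebesgue :: (real^'n) measure" "lebesgue :: (real^'n) measure"
      by (rule pair_sigma_finite_lebesgue)
    let ?B = "ball 0 1 :: (real ^ 'n) set"
    let ?Q = "UNIV - (- ?B) \<times> (- ?B)"
    let ?adm = "admissible_pair s ?B u\<^sub>0 E\<^sub>0"
    have adm: "?adm u E"
      and min: "\<And>v F. ?adm v F \<Longrightarrow> total_energy s \<sigma> ?B u E \<le> total_energy s \<sigma> ?B v F"
      using assms(7) by (auto simp: minimizing_pair_def)
    have [measurable]: "E \<in> sets lebesgue" "E\<^sub>0 \<in> sets lebesgue" "?B \<in> sets lebesgue"
      using adm assms(4) by (auto simp: admissible_pair_def)
    have [measurable]: "- E \<in> sets lebesgue"
      using \<open>E \<in> sets lebesgue\<close> by (auto simp: Compl_eq_Diff_UNIV)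
    have [measurable]: "?Q \<in> sets (lebesgue \<Otimes>\<^sub>M lebesgue)"
      by (rule sets_cross_domain) simp
    have w_meas [measurable]: "w \<in> borel_measurable lebesgue"
      unfolding w_def[abs_def] by measurable

    have w_le: "\<bar>w x\<bar> \<le> 1" for x
      by (simp add: w_def indicator_def)

    have "?adm u\<^sub>0 E\<^sub>0"
      by (auto simp: admissible_pair_def frac_sobolev_def gagliardo_energy_def assms(6) indicator_def
          intro!: AE_I2)
    then have "total_energy s \<sigma> ?B u E \<le> total_energy s \<sigma> ?B u\<^sub>0 E\<^sub>0"
      by (rule min)
    \<comment> \<open>Since \<open>\<sigma> = 2 * s\<close>, the Gagliardo part is a multiple of the
      same perimeter, and local finiteness at radius 1 bounds the sum.\<close>
    also have "\<dots> = 8 * frac_perimeter (2 * s) E\<^sub>0 ?B + frac_perimeter (2 * s) E\<^sub>0 ?B"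
      unfolding total_energy_def assms(3,6) by (subst gagliardo_energy_sign_function) simp_all
    also have "\<dots> < \<infinity>"
      using assms(3,5) by (auto simp: locally_finite_perimeter_def ennreal_mult_less_top)
    \<comment> \<open>Both finite values are cancelled from inequalities below, which
      \<open>ennreal\<close> permits only for finite terms.\<close>
    finally have u_fin: "gagliardo_energy s ?Q u < \<infinity>" and per_fin: "frac_perimeter \<sigma> E ?B < \<infinity>"
      by (auto simp: total_energy_def)
    have u_eq: "gagliardo_energy s ?Q u = gagliardo_energy s ?Q w"
      by (rule gagliardo_energy_cong_AE[OF uw])

    have \<eta>w: "(\<lambda>x. cone_cutoff x * w x) \<in> frac_sobolev s UNIV"
      using assms(1,2) u_fin u_eq
      by (intro cone_cutoff_mult_in_frac_sobolev w_le) auto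
    define B where "B = gagliardo_energy s ?Q (\<lambda>x. cone_cutoff x * w x)"
    have "B \<le> gagliardo_energy s UNIV (\<lambda>x. cone_cutoff x * w x)"
      unfolding B_def gagliardo_energy_eq
      by (intro nn_integral_mono mult_left_mono) (auto simp: indicator_def)
    then have B_fin: "B < \<infinity>"
      using \<eta>w by (auto simp: frac_sobolev_def)
    define J where "J = (\<integral>\<^sup>+p. ennreal (cone_cutoff (fst p) + cone_cutoff (snd p))
      * indicator (E \<times> (- E) \<union> (- E) \<times> E) p * riesz_kernel (2 * s) p * indicator ?Q p
      \<partial>(lebesgue \<Otimes>\<^sub>M lebesgue))"

    have "J = 0"
    proof (rule ennreal_eq_0_if_quadratic_bound[OF B_fin])
      fix t :: real assume t: "0 < t" "t \<le> 1"
      \<comment> \<open>Built on \<open>u\<close> rather than \<open>w\<close>, so that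
        \<open>v - u\<^sub>0\<close> is \<open>u - u\<^sub>0\<close> plus a multiple of the damping
        term; the sum form matches \<open>frac_sobolev_UNIV_add\<close>.\<close>
      define v where "v x = u x + (- t) * (cone_cutoff x * w x)" for x
      have vw: "AE x in lebesgue. v x = w x - t * (cone_cutoff x * w x)"
        using uw by eventually_elim (simp add: v_def)
      have "?adm v E"
        unfolding admissible_pair_def
      proof (intro conjI)
        have "(\<lambda>x. u x - u\<^sub>0 x) \<in> frac_sobolev s UNIV"
          using adm by (simp add: admissible_pair_def)
        from frac_sobolev_UNIV_add[OF this frac_sobolev_UNIV_cmult[OF \<eta>w, of "- t"]]
        show "(\<lambda>x. v x - u\<^sub>0 x) \<in> frac_sobolev s UNIV"
          by (simp add: v_def algebra_simps)
        have "AE x in lebesgue. x \<notin> ?B \<longrightarrow> u x = u\<^sub>0 x"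
          using adm by (simp add: admissible_pair_def)
        then show "AE x in lebesgue. x \<notin> ?B \<longrightarrow> v x = u\<^sub>0 x"
          by eventually_elim (auto simp: v_def cone_cutoff_def)
        show "E \<in> sets lebesgue" "E - ?B = E\<^sub>0 - ?B"
          using adm by (auto simp: admissible_pair_def)
        \<comment> \<open>Almost everywhere \<open>v\<close> is \<open>w\<close> times
          \<open>1 - t * cone_cutoff x\<close>; this factor is nonnegative, so the sign required by
          \<open>E\<close> is kept.\<close>
        have "t * cone_cutoff x \<le> 1" for x :: "real^'n"
          using t cone_cutoff_bounds[of x] by (simp add: mult_le_one)
        then show "AE x in lebesgue. x \<in> E \<inter> ?B \<longrightarrow> 0 \<le> v x"
          "AE x in lebesgue. x \<in> - E \<inter> ?B \<longrightarrow> v x \<le> 0"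
          using vw by (auto simp: w_def elim!: eventually_mono)
      qed
      then have "total_energy s \<sigma> ?B u E \<le> total_energy s \<sigma> ?B v E"
        by (rule min)
      then have "gagliardo_energy s ?Q u \<le> gagliardo_energy s ?Q v"
        using per_fin by (auto simp: total_energy_def)
      \<comment> \<open>Adding the cross term to both sides brings the right side into the form of
        the subtraction-free expansion.\<close>
      then have "gagliardo_energy s ?Q w + ennreal (4 * t) * J \<le> gagliardo_energy s ?Q v + ennreal (4 * t) * J"
        unfolding u_eq by (rule add_right_mono)
      also have "\<dots> = gagliardo_energy s ?Q w + ennreal (t\<^sup>2) * B"
        unfolding gagliardo_energy_cong_AE[OF vw] J_def B_def w_def[abs_def]
        by (rule gagliardo_energy_damped_sign_function) (use t cone_cutoff_bounds in auto)
      finally show "ennreal (4 * t) * J \<le> ennreal (t\<^sup>2) * B"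
        using u_fin u_eq by auto
    qed
    then have ae: "AE p in lebesgue \<Otimes>\<^sub>M lebesgue. ennreal (cone_cutoff (fst p) + cone_cutoff (snd p))
      * indicator (E \<times> (- E) \<union> (- E) \<times> E) p * riesz_kernel (2 * s) p * indicator ?Q p = 0"
      unfolding J_def
    proof (subst (asm) nn_integral_0_iff_AE)
      show "(\<lambda>p. ennreal (cone_cutoff (fst p) + cone_cutoff (snd p))
          * indicator (E \<times> (- E) \<union> (- E) \<times> E) p * riesz_kernel (2 * s) p * indicator ?Q p)
        \<in> borel_measurable (lebesgue \<Otimes>\<^sub>M lebesgue)"
        by measurable
    qed
    \<comment> \<open>On such a product no factor of the integrand vanishes: the points lie on
      opposite sides of \<open>E\<close>, hence are distinct, and one of them is in the ball. The
      product is therefore contained in the exceptional null set.\<close>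
    have null: "S \<times> T \<in> null_sets (lebesgue \<Otimes>\<^sub>M lebesgue)"
      if [measurable]: "S \<in> sets lebesgue" "T \<in> sets lebesgue"
        and "S \<subseteq> E" "T \<subseteq> - E" "S \<subseteq> ?B \<or> T \<subseteq> ?B" for S T
    proof -
      have "AE p in lebesgue \<Otimes>\<^sub>M lebesgue. p \<notin> S \<times> T"
        using ae
      proof eventually_elim
        fix p assume eq0: "ennreal (cone_cutoff (fst p) + cone_cutoff (snd p))
          * indicator (E \<times> (- E) \<union> (- E) \<times> E) p * riesz_kernel (2 * s) p * indicator ?Q p = 0"
        show "p \<notin> S \<times> T"
        proof
          assume p: "p \<in> S \<times> T"
          then have "fst p \<in> E" "snd p \<notin> E" "fst p \<in> ?B \<or> snd p \<in> ?B"
            using that by auto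
          moreover from this have "0 < cone_cutoff (fst p) + cone_cutoff (snd p)"
            using cone_cutoff_bounds(1)[of "fst p"] cone_cutoff_bounds(1)[of "snd p"]
              cone_cutoff_pos_iff[of "fst p"] cone_cutoff_pos_iff[of "snd p"]
            by (auto simp del: mem_ball)
          moreover have "fst p \<noteq> snd p" using calculation by auto
          ultimately show False
            using eq0 p \<open>fst p \<in> ?B \<or> snd p \<in> ?B\<close>
            by (auto simp: riesz_kernel_def indicator_def mem_Times_iff simp del: mem_ball)
        qed
      qed
      moreover have "S \<times> T \<in> sets (lebesgue \<Otimes>\<^sub>M lebesgue)"
        using that(1,2) by (rule pair_measureI)
      ultimately show ?thesis
        by (simp only: AE_iff_null_sets)
    qed
    have null_factor: "S \<in> null_sets lebesgue \<or> T \<in> null_sets lebesgue"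
      if ST: "S \<in> sets lebesgue" "T \<in> sets lebesgue" "S \<times> T \<in> null_sets (lebesgue \<Otimes>\<^sub>M lebesgue)"
      for S T :: "(real ^ 'n) set"
    proof -
      have "emeasure lebesgue S * emeasure lebesgue T = 0"
        using null_setsD1[OF ST(3)]
        unfolding sigma_finite_measure.emeasure_pair_measure_Times[OF sigma_finite_lebesgue ST(1,2)] .
      then show ?thesis using ST(1,2) by (auto simp only: null_sets_def mult_eq_0_iff mem_Collect_eq)
    qed
    have "- E \<notin> null_sets lebesgue" "E \<notin> null_sets lebesgue"
      using \<open>\<not> (negligible (- E) \<or> negligible E)\<close> by (simp_all only: negligible_iff_null_sets de_Morgan_disj not_False_eq_True)
    \<comment> \<open>One side is cut down to the ball while the other is kept whole, in both ways.
      The whole side is not null, so the part in the ball must be.\<close>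
    moreover have "E \<inter> ?B \<in> null_sets lebesgue \<or> - E \<in> null_sets lebesgue"
      using \<open>E \<in> sets lebesgue\<close> \<open>- E \<in> sets lebesgue\<close> \<open>?B \<in> sets lebesgue\<close>
      by (intro null_factor null sets.Int Int_lower1 Int_lower2 disjI1 subset_refl)
    moreover have "E \<in> null_sets lebesgue \<or> - E \<inter> ?B \<in> null_sets lebesgue"
      using \<open>E \<in> sets lebesgue\<close> \<open>- E \<in> sets lebesgue\<close> \<open>?B \<in> sets lebesgue\<close>
      by (intro null_factor null sets.Int Int_lower1 Int_lower2 disjI2 subset_refl)
    ultimately have "E \<inter> ?B \<in> null_sets lebesgue" "- E \<inter> ?B \<in> null_sets lebesgue"
      by simp_all
    then have "(E \<inter> ?B) \<union> (- E \<inter> ?B) \<in> null_sets lebesgue"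
      by (rule null_sets.Un)
    also have "(E \<inter> ?B) \<union> (- E \<inter> ?B) = ?B" by blast
    finally have "negligible ?B"
      unfolding negligible_iff_null_sets .
    moreover have "\<not> negligible ?B"
      by (rule open_not_negligible) simp_all
    ultimately show False by contradiction
  qed
qed

end
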